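(* Any (randomized) algorithm that, given {\textsc{COND-PR}} access (respectively {\textsc{COND}} access) to an unknown distribution $D$ on $[n]$, estimates $\ell_2^2(D)=\sum_{j\in[n]}D(j)^2$ within a multiplicative $5/4$-factor with probability at least $2/3$, must make $\tilde{\Omega}(\sqrt{n})$ queries to the {\textsc{COND-PR}} (respectively {\textsc{COND}}) oracle.
   Context: For a distribution $D$ on $[n]=\{1,\dots,n\}$ and $S\subseteq[n]$, $D(S)=\sum_{i\in S}D(i)$. A {\textsc{COND}} oracle for $D$ takes any $S\subseteq[n]$ (possibly adaptively chosen) and, if $D(S)>0$, returns $j\in S$ with probability $D(j)/D(S)$; if $D(S)=0$ it returns "failure". A {\textsc{COND-PR}} oracle is the same except that it returns the pair $(j,D(j))$. A multiplicative $5/4$-factor estimate $\hat{v}$ of a value $v$ satisfies $\frac45 v\le\hat{v}\le\frac54 v$. $\tilde{\Omega}$ hides polylogarithmic factors in $n$. The guarantee must hold for every distribution $D$ on $[n]$. *)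

theory Defs
  imports "HOL-Probability.Probability"
begin

text \<open>
  A randomized adaptive algorithm is a function from transcripts (the queries made so far with
  their answers, oldest first) to a random next action: either query the oracle or halt with an
  output. The transcript is all that an algorithm ever learns about the unknown distribution, and
  the internal coin tosses are absorbed in the \<open>pmf\<close>; there is no computability requirement.
\<close>

datatype action = Query "nat set" | Output real

type_synonym 'r algorithm = "(nat set \<times> 'r) list \<Rightarrow> action pmf"

text \<open>
  In \<open>run Orc A q h\<close> the algorithm \<open>A\<close> is continued from transcript \<open>h\<close> with at most \<open>q\<close> further
  queries; the result is \<open>None\<close> iff it attempts to make a further one.
\<close>

primrec run :: "(nat set \<Rightarrow> 'r pmf) \<Rightarrow> 'r algorithm \<Rightarrow> nat \<Rightarrow> (nat set \<times> 'r) list \<Rightarrow> real option pmf" where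
  "run Orc A 0 h =
     map_pmf (\<lambda>a. case a of Query S \<Rightarrow> None | Output v \<Rightarrow> Some v) (A h)"
| "run Orc A (Suc q) h =
     bind_pmf (A h) (\<lambda>a. case a of
         Query S \<Rightarrow> bind_pmf (Orc S) (\<lambda>r. run Orc A q (h @ [(S, r)]))
       | Output v \<Rightarrow> return_pmf (Some v))"

definition distributions :: "nat \<Rightarrow> nat pmf set" where
  "distributions n = {D. set_pmf D \<subseteq> {1..n}}"

text \<open>The answer \<open>None\<close> of an oracle is ``failure''.\<close>

definition COND :: "nat pmf \<Rightarrow> nat set \<Rightarrow> nat option pmf" where
  "COND D S =
     (if measure_pmf.prob D S > 0 then map_pmf Some (cond_pmf D S) else return_pmf None)"

definition COND_PR :: "nat pmf \<Rightarrow> nat set \<Rightarrow> (nat \<times> real) option pmf" where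
  "COND_PR D S =
     (if measure_pmf.prob D S > 0 then map_pmf (\<lambda>j. Some (j, pmf D j)) (cond_pmf D S)
      else return_pmf None)"

definition l2_sq :: "nat \<Rightarrow> nat pmf \<Rightarrow> real" where
  "l2_sq n D = (\<Sum>j\<in>{1..n}. (pmf D j)\<^sup>2)"

definition estimate_5_4 :: "real \<Rightarrow> real \<Rightarrow> bool" where
  "estimate_5_4 v' v \<longleftrightarrow> 4/5 * v \<le> v' \<and> v' \<le> 5/4 * v"

definition queries_within :: "nat \<Rightarrow> 'r algorithm \<Rightarrow> bool" where
  "queries_within n A \<longleftrightarrow> (\<forall>h S. Query S \<in> set_pmf (A h) \<longrightarrow> S \<subseteq> {1..n})"

text \<open>
  The parameter \<open>Orc\<close> below is the kind of access, mapping a distribution to its oracle. The number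
  of queries is the worst case over all distributions on \<open>{1..n}\<close>, oracle answers and coin tosses.
\<close>

definition makes_at_most_queries ::
  "(nat pmf \<Rightarrow> nat set \<Rightarrow> 'r pmf) \<Rightarrow> nat \<Rightarrow> 'r algorithm \<Rightarrow> nat \<Rightarrow> bool" where
  "makes_at_most_queries Orc n A q \<longleftrightarrow>
     (\<forall>D\<in>distributions n. None \<notin> set_pmf (run (Orc D) A q []))"

definition l2_sq_estimator ::
  "(nat pmf \<Rightarrow> nat set \<Rightarrow> 'r pmf) \<Rightarrow> nat \<Rightarrow> 'r algorithm \<Rightarrow> nat \<Rightarrow> bool" where
  "l2_sq_estimator Orc n A q \<longleftrightarrow>
     queries_within n A \<and>
     makes_at_most_queries Orc n A q \<and>
     (\<forall>D\<in>distributions n.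
        measure_pmf.prob (run (Orc D) A q []) {Some v' | v'. estimate_5_4 v' (l2_sq n D)} \<ge> 2/3)"

end

theory Submission imports Defs begin

text \<open>
  Let \<open>t = \<lfloor>sqrt n\<rfloor>\<close> and cut \<open>{1..t\<^sup>2}\<close> into \<open>t\<close> blocks of length \<open>t\<close>. Compare the uniform
  distribution on \<open>{1..t\<^sup>2}\<close> with the spiked distributions that move the mass of the block of \<open>a\<close> onto
  the single point \<open>a\<close>; all other points keep their probability, so the probabilities revealed by
  COND-PR carry no extra information. The spike almost doubles the squared \<open>\<ell>\<^sub>2\<close> norm.

  For a uniformly random \<open>a\<close>, a fixed answer lies in the block of \<open>a\<close> with probability \<open>1 / t\<close>. If a
  query contains \<open>s\<close> points of \<open>{1..t\<^sup>2}\<close>, then it contains \<open>a\<close> with probability \<open>s / t\<^sup>2\<close>, and this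
  lowers the likelihood of an answer outside the block at most by the fraction \<open>t / (s + t)\<close>. Hence the
  averaged likelihood of any transcript of \<open>q\<close> queries is at least \<open>1 - 2 * q / t\<close> times its likelihood
  under the uniform distribution, and an estimator needs \<open>q \<ge> t / 4\<close>.
\<close>

section \<open>Change of measure and the averaged likelihood bound for adaptive runs\<close>

lemma integrable_pmf_unit:
  fixes f :: "'a \<Rightarrow> real"
  assumes "\<And>x. 0 \<le> f x" "\<And>x. f x \<le> 1"
  shows "integrable (measure_pmf p) f"
  by (rule measure_pmf.integrable_const_bound[where B = 1]) (use assms in auto)

text \<open>Both sides are integrals against the counting measure, and \<open>dom\<close> multiplied
  by \<open>f x\<close> compares the integrands. This trades the answers of one oracle for those of
  another at the price of the factor \<open>W\<close>.\<close>

lemma expectation_mono_dominated: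
  fixes f W :: "'a \<Rightarrow> real"
  assumes dom: "\<And>x. pmf p x * W x \<le> pmf q x"
    and W: "\<And>x. 0 \<le> W x" "\<And>x. W x \<le> 1"
    and f: "\<And>x. 0 \<le> f x" "\<And>x. f x \<le> 1"
  shows "measure_pmf.expectation p (\<lambda>x. W x * f x) \<le> measure_pmf.expectation q f"
proof -
  have density: "measure_pmf.expectation r g = integral\<^sup>L (count_space UNIV) (\<lambda>x. pmf r x * g x)"
       "integrable (count_space UNIV) (\<lambda>x. pmf r x * g x)"
    if "\<And>x. 0 \<le> g x" "\<And>x. g x \<le> 1" for r :: "'a pmf" and g :: "'a \<Rightarrow> real"
    using integrable_pmf_unit[of g r] that
    by (simp_all add: measure_pmf_eq_density integral_density integrable_density)
  have Wf: "0 \<le> W x * f x" "W x * f x \<le> 1" for x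
    using W[of x] f[of x] by (auto intro: mult_le_one)
  have "pmf p x * (W x * f x) \<le> pmf q x * f x" for x
    using mult_right_mono[OF dom[of x] f(1)[of x]] by (simp add: mult.assoc)
  then show ?thesis
    by (subst (1 2) density) (auto intro!: integral_mono density f Wf)
qed

lemma prob_bind_pmf:
  "measure_pmf.prob (bind_pmf p k) E = measure_pmf.expectation p (\<lambda>x. measure_pmf.prob (k x) E)"
  unfolding measure_pmf_bind
  by (rule measure_pmf.measure_bind[where N = "count_space UNIV"])
    (auto simp: space_subprob_algebra intro: prob_space_imp_subprob_space prob_space_measure_pmf)

text \<open>
  The number \<open>W i S r\<close> bounds from below the likelihood ratio of the answer \<open>r\<close> to the query \<open>S\<close>.
  The weights \<open>w\<close> collect the likelihood ratios of the answers already given.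
\<close>

lemma run_prob_sum_ge:
  fixes Ref :: "nat set \<Rightarrow> 'r pmf" and Orc :: "'i \<Rightarrow> nat set \<Rightarrow> 'r pmf"
    and W :: "'i \<Rightarrow> nat set \<Rightarrow> 'r \<Rightarrow> real"
  assumes \<delta>: "0 \<le> \<delta>"
    and W0: "\<And>i S r. i \<in> I \<Longrightarrow> 0 \<le> W i S r"
    and W1: "\<And>i S r. i \<in> I \<Longrightarrow> W i S r \<le> 1"
    and dom: "\<And>i S r. i \<in> I \<Longrightarrow> pmf (Ref S) r * W i S r \<le> pmf (Orc i S) r"
    and loss: "\<And>S r. r \<in> set_pmf (Ref S) \<Longrightarrow> (\<Sum>i\<in>I. 1 - W i S r) \<le> \<delta>"
    and w: "\<And>i. i \<in> I \<Longrightarrow> 0 \<le> w i" "\<And>i. i \<in> I \<Longrightarrow> w i \<le> 1"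
  shows "((\<Sum>i\<in>I. w i) - real q * \<delta>) * measure_pmf.prob (run Ref A q h) E
           \<le> (\<Sum>i\<in>I. w i * measure_pmf.prob (run (Orc i) A q h) E)"
  using w
\<comment> \<open>The weights must vary: after the answer \<open>r\<close> to \<open>S\<close> the
  weight of \<open>i\<close> becomes \<open>w i * W i S r\<close>.\<close>
proof (induction q arbitrary: h w)
  case 0
  show ?case by (simp add: sum_distrib_right)
next
  case (Suc q)
  define F where "F Or a = (case a of
         Query S \<Rightarrow> bind_pmf (Or S) (\<lambda>r. run Or A q (h @ [(S, r)]))
       | Output v \<Rightarrow> return_pmf (Some v))" for Or :: "nat set \<Rightarrow> 'r pmf" and a
  have int: "integrable (measure_pmf p) (\<lambda>x. measure_pmf.prob (k x) E)"
    for p :: "'b pmf" and k :: "'b \<Rightarrow> real option pmf"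
    by (rule integrable_pmf_unit) auto
  have step: "((\<Sum>i\<in>I. w i) - real (Suc q) * \<delta>) * measure_pmf.prob (F Ref a) E
      \<le> (\<Sum>i\<in>I. w i * measure_pmf.prob (F (Orc i) a) E)" for a
  proof (cases a)
    case (Output v)
    have "((\<Sum>i\<in>I. w i) - real (Suc q) * \<delta>) * measure_pmf.prob (return_pmf (Some v)) E
        \<le> (\<Sum>i\<in>I. w i) * measure_pmf.prob (return_pmf (Some v)) E"
      using \<delta> by (intro mult_right_mono) auto
    then show ?thesis by (simp add: F_def Output sum_distrib_right)
  next
    case (Query S)
    define P where "P Or r = measure_pmf.prob (run Or A q (h @ [(S, r)])) E" for Or r
    have P: "0 \<le> P Or r" "P Or r \<le> 1" for Or r by (auto simp: P_def)
    have "((\<Sum>i\<in>I. w i) - real (Suc q) * \<delta>) * measure_pmf.expectation (Ref S) (P Ref)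
        = measure_pmf.expectation (Ref S) (\<lambda>r. ((\<Sum>i\<in>I. w i) - real (Suc q) * \<delta>) * P Ref r)"
      by simp
    also have "\<dots> \<le> measure_pmf.expectation (Ref S) (\<lambda>r. \<Sum>i\<in>I. w i * (W i S r * P (Orc i) r))"
    proof (rule integral_mono_AE)
      show "integrable (Ref S) (\<lambda>r. ((\<Sum>i\<in>I. w i) - real (Suc q) * \<delta>) * P Ref r)"
        by (intro integrable_mult_right integrable_pmf_unit P)
      show "integrable (Ref S) (\<lambda>r. \<Sum>i\<in>I. w i * (W i S r * P (Orc i) r))"
        by (intro Bochner_Integration.integrable_sum integrable_mult_right integrable_pmf_unit)
          (auto intro!: mult_le_one mult_nonneg_nonneg P W0 W1)
      show "AE r in Ref S. ((\<Sum>i\<in>I. w i) - real (Suc q) * \<delta>) * P Ref r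
          \<le> (\<Sum>i\<in>I. w i * (W i S r * P (Orc i) r))"
      proof (rule AE_pmfI)
        fix r assume r: "r \<in> set_pmf (Ref S)"
        have "(\<Sum>i\<in>I. w i) - (\<Sum>i\<in>I. w i * W i S r) = (\<Sum>i\<in>I. w i * (1 - W i S r))"
          by (simp add: sum_subtractf right_diff_distrib)
        \<comment> \<open>The old weights are at most 1, so each query costs at most \<delta> of
          total weight, whatever the history.\<close>
        also have "\<dots> \<le> (\<Sum>i\<in>I. 1 - W i S r)"
          using Suc.prems W1 by (intro sum_mono mult_left_le_one_le) auto
        also have "\<dots> \<le> \<delta>" by (rule loss[OF r])
        finally have "((\<Sum>i\<in>I. w i) - real (Suc q) * \<delta>) * P Ref r
            \<le> ((\<Sum>i\<in>I. w i * W i S r) - real q * \<delta>) * P Ref r"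
          using P by (intro mult_right_mono) (auto simp: algebra_simps)
        also have "\<dots> \<le> (\<Sum>i\<in>I. w i * W i S r * P (Orc i) r)"
          unfolding P_def using Suc.prems W0 W1 by (intro Suc.IH) (auto intro: mult_le_one)
        finally show "((\<Sum>i\<in>I. w i) - real (Suc q) * \<delta>) * P Ref r
            \<le> (\<Sum>i\<in>I. w i * (W i S r * P (Orc i) r))" by (simp add: mult.assoc)
      qed
    qed
    also have "\<dots> = (\<Sum>i\<in>I. w i * measure_pmf.expectation (Ref S) (\<lambda>r. W i S r * P (Orc i) r))"
      by (subst Bochner_Integration.integral_sum)
        (auto intro!: integrable_mult_right integrable_pmf_unit mult_le_one mult_nonneg_nonneg P W0 W1)
    \<comment> \<open>The factor \<open>W\<close> pays for passing from the answers of
      \<open>Ref\<close> to those of \<open>Orc i\<close>.\<close>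
    also have "\<dots> \<le> (\<Sum>i\<in>I. w i * measure_pmf.expectation (Orc i S) (P (Orc i)))"
      using Suc.prems P W0 W1 dom
      by (intro sum_mono mult_left_mono expectation_mono_dominated) auto
    finally show ?thesis by (simp add: F_def Query prob_bind_pmf P_def[abs_def])
  qed
  have "((\<Sum>i\<in>I. w i) - real (Suc q) * \<delta>)
        * measure_pmf.expectation (A h) (\<lambda>a. measure_pmf.prob (F Ref a) E)
      = measure_pmf.expectation (A h)
          (\<lambda>a. ((\<Sum>i\<in>I. w i) - real (Suc q) * \<delta>) * measure_pmf.prob (F Ref a) E)"
    by simp
  also have "\<dots> \<le> measure_pmf.expectation (A h) (\<lambda>a. \<Sum>i\<in>I. w i * measure_pmf.prob (F (Orc i) a) E)"
    by (intro integral_mono Bochner_Integration.integrable_sum integrable_mult_right int step)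
  also have "\<dots> = (\<Sum>i\<in>I. w i * measure_pmf.expectation (A h) (\<lambda>a. measure_pmf.prob (F (Orc i) a) E))"
    by (subst Bochner_Integration.integral_sum) (auto intro!: integrable_mult_right int)
  finally show ?case by (simp add: F_def prob_bind_pmf)
qed

section \<open>Blocks, hard instances and a common form of both oracles\<close>

definition block :: "nat \<Rightarrow> nat \<Rightarrow> nat set" where
  "block t a = {(a - 1) div t * t + 1 .. (a - 1) div t * t + t}"

lemma card_block: "card (block t a) = t"
  and finite_block: "finite (block t a)"
  by (simp_all add: block_def)

lemma mem_block_iff:
  assumes "t > 0" "x > 0"
  shows "x \<in> block t a \<longleftrightarrow> (x - 1) div t = (a - 1) div t"
proof -
  obtain y where y: "x = Suc y" using assms(2) gr0_implies_Suc by blast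
  have "y div t = b \<longleftrightarrow> b * t \<le> y \<and> y < b * t + t" for b
    using assms(1) div_nat_eqI[of t b y] dividend_less_div_times[of t y]
      div_times_less_eq_dividend[of y t]
    by (auto simp: mult.commute add.commute)
  from this[of "(a - 1) div t"] show ?thesis by (auto simp: y block_def)
qed

lemma block_subset:
  assumes "a \<in> {1..t * t}"
  shows "block t a \<subseteq> {1..t * t}"
proof -
  have "(a - 1) div t < t" using assms by (auto intro!: less_mult_imp_div_less)
  then have "((a - 1) div t + 1) * t \<le> t * t" by (intro mult_right_mono) auto
  then show ?thesis by (auto simp: block_def)
qed

text \<open>Sharing a block is a symmetric relation. Hence a given answer is ruled out by exactly
  \<open>t\<close> spikes.\<close>

lemma blocks_containing:
  assumes "t > 0" "x \<in> {1..t * t}"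
  shows "{a \<in> {1..t * t}. x \<in> block t a} = block t x"
  using assms block_subset[OF assms(2)] by (force simp: mem_block_iff)

definition collapse :: "nat \<Rightarrow> nat \<Rightarrow> nat \<Rightarrow> nat" where
  "collapse t a x = (if x \<in> block t a then a else x)"

definition unif :: "nat \<Rightarrow> nat pmf" where
  "unif t = pmf_of_set {1..t * t}"

text \<open>As an image of \<open>unif t\<close>, its probabilities reduce to counting
  preimages.\<close>

definition spiked :: "nat \<Rightarrow> nat \<Rightarrow> nat pmf" where
  "spiked t a = map_pmf (collapse t a) (unif t)"

text \<open>Here \<open>g D j\<close> is what the oracle reveals about the drawn point
  \<open>j\<close>. The lower bound needs only that it determines \<open>j\<close> and depends on
  \<open>D\<close> through \<open>pmf D j\<close> alone, which covers both oracles.\<close>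

definition access :: "(nat pmf \<Rightarrow> nat \<Rightarrow> 'r) \<Rightarrow> nat pmf \<Rightarrow> nat set \<Rightarrow> 'r option pmf" where
  "access g D S =
     (if measure_pmf.prob D S > 0 then map_pmf (\<lambda>j. Some (g D j)) (cond_pmf D S)
      else return_pmf None)"

lemma COND_eq_access: "COND = access (\<lambda>D j. j)"
  by (intro ext) (simp add: COND_def access_def)

lemma COND_PR_eq_access: "COND_PR = access (\<lambda>D j. (j, pmf D j))"
  by (intro ext) (simp add: COND_PR_def access_def)

lemma pmf_access:
  assumes "inj (g D)" "j \<in> S" "pmf D j > 0"
  shows "pmf (access g D S) (Some (g D j)) = pmf D j / measure_pmf.prob D S"
    and "measure_pmf.prob D S > 0"
proof -
  have j: "j \<in> set_pmf D" using assms(3) by (simp add: set_pmf_iff)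
  show pos: "measure_pmf.prob D S > 0"
    using j assms(2) by (rule measure_pmf_posI)
  have "inj (\<lambda>j. Some (g D j))" using assms(1) by (auto simp: inj_def)
  then have "pmf (map_pmf (\<lambda>j. Some (g D j)) (cond_pmf D S)) (Some (g D j)) = pmf (cond_pmf D S) j"
    by (rule pmf_map_inj')
  also have "\<dots> = pmf D j / measure_pmf.prob D S"
    using j assms(2) by (subst pmf_cond) auto
  finally show "pmf (access g D S) (Some (g D j)) = pmf D j / measure_pmf.prob D S"
    using pos by (simp add: access_def)
qed

context
  fixes t :: nat
  assumes t: "t > 0"
begin

section \<open>Probabilities and squared norms of the hard instances\<close>

lemma prob_unif: "measure_pmf.prob (unif t) S = card ({1..t * t} \<inter> S) / (t * t)"
  using t unfolding unif_def by (subst measure_pmf_of_set) auto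

lemma pmf_unif: "pmf (unif t) j = (if j \<in> {1..t * t} then 1 / (t * t) else 0)"
  using t unfolding unif_def by (subst pmf_of_set) (auto simp: indicator_def)

lemma set_pmf_unif: "set_pmf (unif t) = {1..t * t}"
  using t unfolding unif_def by (subst set_pmf_of_set) auto

lemma prob_spiked: "measure_pmf.prob (spiked t a) S = card ({1..t * t} \<inter> collapse t a -` S) / (t * t)"
  by (simp add: spiked_def prob_unif)

lemma spiked_in_distributions:
  assumes "a \<in> {1..t * t}" "t * t \<le> n"
  shows "spiked t a \<in> distributions n"
  using assms by (auto simp: distributions_def spiked_def set_pmf_unif collapse_def)

lemma unif_in_distributions: "t * t \<le> n \<Longrightarrow> unif t \<in> distributions n"
  by (auto simp: distributions_def set_pmf_unif)

lemma self_mem_block: "a \<in> {1..t * t} \<Longrightarrow> a \<in> block t a"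
  using t by (simp add: mem_block_iff)

lemma pmf_spiked:
  assumes "a \<in> {1..t * t}"
  shows "pmf (spiked t a) j = (if j = a then 1 / t
    else if j \<in> {1..t * t} - block t a then 1 / (t * t) else 0)"
proof -
  have "{1..t * t} \<inter> collapse t a -` {j} = (if j = a then block t a
    else if j \<in> {1..t * t} - block t a then {j} else {})"
    using assms block_subset[OF assms] self_mem_block[OF assms] by (auto simp: collapse_def split: if_splits)
  then show ?thesis
    using prob_spiked[of a "{j}"] t by (simp add: measure_pmf_single card_block)
qed

lemma l2_sq_unif:
  assumes "t * t \<le> n"
  shows "l2_sq n (unif t) = 1 / (t * t)"
proof -
  have "l2_sq n (unif t) = (\<Sum>j\<in>{1..t * t}. (1 / (t * t))\<^sup>2)"
    unfolding l2_sq_def using assms by (intro sum.mono_neutral_cong_right) (auto simp: pmf_unif)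
  then show ?thesis using t by (simp add: power2_eq_square)
qed

text \<open>The spike alone contributes \<open>1 / t\<close> squared, as much as the whole uniform
  distribution; the \<open>t * t - t\<close> points outside the block keep their share.\<close>

lemma l2_sq_spiked:
  assumes a: "a \<in> {1..t * t}" and n: "t * t \<le> n"
  shows "l2_sq n (spiked t a) = (2 - 1 / t) / (t * t)"
proof -
  have sub: "insert a ({1..t * t} - block t a) \<subseteq> {1..n}" using a n by auto
  have "l2_sq n (spiked t a) = (\<Sum>j\<in>insert a ({1..t * t} - block t a). (pmf (spiked t a) j)\<^sup>2)"
    unfolding l2_sq_def using sub by (intro sum.mono_neutral_right) (auto simp: pmf_spiked[OF a])
  also have "\<dots> = (1 / t)\<^sup>2 + (\<Sum>j\<in>{1..t * t} - block t a. (1 / (t * t))\<^sup>2)"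
  proof -
    have "(\<Sum>j\<in>{1..t * t} - block t a. (pmf (spiked t a) j)\<^sup>2)
        = (\<Sum>j\<in>{1..t * t} - block t a. (1 / (t * t))\<^sup>2)"
      using self_mem_block[OF a] by (intro sum.cong) (auto simp: pmf_spiked[OF a])
    then show ?thesis using self_mem_block[OF a] by (simp add: pmf_spiked[OF a])
  qed
  also have "\<dots> = (1 / t)\<^sup>2 + (real t * t - t) * (1 / (t * t))\<^sup>2"
    using t card_Diff_subset[OF finite_block block_subset[OF a]]
    by (simp add: card_block of_nat_diff)
  also have "\<dots> = (2 - 1 / t) / (t * t)"
    using t by (simp add: field_simps power2_eq_square)
  finally show ?thesis .
qed

section \<open>Likelihood ratios of single answers\<close>

text \<open>
  Every answer outside the block of \<open>a\<close> has likelihood ratio at least \<open>s / (s + t)\<close>, where \<open>s\<close> is the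
  number of points of \<open>S\<close> in the support of the uniform distribution, and at least \<open>1\<close> if \<open>a \<notin> S\<close>.
\<close>

definition likelihood_bound :: "(nat pmf \<Rightarrow> nat \<Rightarrow> 'r) \<Rightarrow> nat \<Rightarrow> nat set \<Rightarrow> 'r option \<Rightarrow> real" where
  "likelihood_bound g a S r =
     (if \<exists>j\<in>block t a. r = Some (g (unif t) j) then 0
      else if a \<in> S then card ({1..t * t} \<inter> S) / (card ({1..t * t} \<inter> S) + t) else 1)"

lemma likelihood_bound_nonneg: "0 \<le> likelihood_bound g a S r"
  and likelihood_bound_le_1: "likelihood_bound g a S r \<le> 1"
  by (auto simp: likelihood_bound_def divide_le_eq_1)

text \<open>A point that collapses into \<open>S\<close> lies in \<open>S\<close> already, or lies
  in the block of \<open>a\<close> while \<open>a \<in> S\<close>.\<close>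

lemma prob_spiked_le:
  assumes a: "a \<in> {1..t * t}"
  shows "measure_pmf.prob (spiked t a) S
    \<le> (card ({1..t * t} \<inter> S) + (if a \<in> S then t else 0)) / (t * t)"
proof -
  have "card ({1..t * t} \<inter> collapse t a -` S)
      \<le> card ({1..t * t} \<inter> S \<union> (if a \<in> S then block t a else {}))"
    by (rule card_mono) (auto simp: collapse_def finite_block split: if_splits)
  also have "\<dots> \<le> card ({1..t * t} \<inter> S) + card (if a \<in> S then block t a else {})"
    by (rule card_Un_le)
  finally have "real (card ({1..t * t} \<inter> collapse t a -` S))
      \<le> card ({1..t * t} \<inter> S) + (if a \<in> S then t else 0)"
    by (auto simp: card_block split: if_splits)
  then show ?thesis unfolding prob_spiked by (intro divide_right_mono) auto
qed

lemma set_pmf_access_unif: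
  assumes "r \<in> set_pmf (access g (unif t) S)"
  shows "r = None \<and> {1..t * t} \<inter> S = {}
    \<or> (\<exists>j\<in>{1..t * t} \<inter> S. r = Some (g (unif t) j))"
proof (cases "measure_pmf.prob (unif t) S > 0")
  case True
  then have "set_pmf (unif t) \<inter> S \<noteq> {}"
    by (metis measure_pmf_zero_iff less_irrefl)
  then show ?thesis using assms True by (auto simp: access_def set_cond_pmf set_pmf_unif)
next
  case False
  then have "measure_pmf.prob (unif t) S = 0" by (simp add: zero_less_measure_iff)
  then show ?thesis using assms False
    by (auto simp: access_def measure_pmf_zero_iff set_pmf_unif)
qed

text \<open>A point outside the block keeps its probability, so only the normalizing mass of
  \<open>S\<close> changes, from \<open>s / (t * t)\<close> to at most
  \<open>m / (t * t)\<close>.\<close>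

lemma access_dominated:
  assumes inj: "\<And>D. inj (g D)" and cong: "\<And>D D' j. pmf D j = pmf D' j \<Longrightarrow> g D j = g D' j"
    and a: "a \<in> {1..t * t}"
  shows "pmf (access g (unif t) S) r * likelihood_bound g a S r \<le> pmf (access g (spiked t a) S) r"
proof (cases "r \<in> set_pmf (access g (unif t) S) \<and> likelihood_bound g a S r \<noteq> 0")
  case False
  then show ?thesis by (auto simp: set_pmf_iff)
next
  case True
  from set_pmf_access_unif[OF conjunct1[OF True]] show ?thesis
  proof
    assume r: "r = None \<and> {1..t * t} \<inter> S = {}"
    \<comment> \<open>If \<open>S\<close> misses the support then \<open>a \<notin> S\<close>, so
      the spiked oracle fails as well.\<close>
    then have "\<not> measure_pmf.prob (spiked t a) S > 0"
      using prob_spiked_le[OF a, of S] a by (auto split: if_splits)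
    then have "pmf (access g (spiked t a) S) r = 1" using r by (simp add: access_def)
    then show ?thesis
      by (simp add: mult_le_one pmf_le_1 likelihood_bound_nonneg likelihood_bound_le_1)
  next
    assume "\<exists>j\<in>{1..t * t} \<inter> S. r = Some (g (unif t) j)"
    then obtain j where j: "j \<in> {1..t * t}" "j \<in> S" "r = Some (g (unif t) j)" by auto
    have no_block: "\<not> (\<exists>j\<in>block t a. r = Some (g (unif t) j))"
      using True by (simp add: likelihood_bound_def split: if_splits)
    then have nb: "j \<notin> block t a" using j(3) by auto
    then have "j \<noteq> a" using self_mem_block[OF a] by auto
    then have pj: "pmf (unif t) j = 1 / (t * t)" "pmf (spiked t a) j = 1 / (t * t)"
      using j nb by (simp_all add: pmf_unif pmf_spiked[OF a])
    \<comment> \<open>Equal probabilities make both oracles reveal the same answer.\<close>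
    have r': "r = Some (g (spiked t a) j)" using j(3) cong[of "unif t" j "spiked t a"] pj by simp
    define s where "s = card ({1..t * t} \<inter> S)"
    define m where "m = real s + (if a \<in> S then real t else 0)"
    have s: "s > 0" using j unfolding s_def by (auto simp: card_gt_0_iff)
    have "pmf (access g (unif t) S) r = 1 / s"
      using pmf_access(1)[where g = g and D = "unif t", OF inj j(2)] pj t s j(3)
      by (simp add: prob_unif s_def)
    moreover have "likelihood_bound g a S r = s / m"
      using no_block s unfolding likelihood_bound_def m_def s_def[symmetric] by simp
    ultimately have "pmf (access g (unif t) S) r * likelihood_bound g a S r = 1 / m"
      using s by simp
    also have "\<dots> = (1 / (t * t)) / (m / (t * t))" using t by simp
    also have "\<dots> \<le> (1 / (t * t)) / measure_pmf.prob (spiked t a) S"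
    proof (rule divide_left_mono)
      show "measure_pmf.prob (spiked t a) S \<le> m / (t * t)"
        using prob_spiked_le[OF a, of S] by (simp add: m_def s_def split: if_splits)
      have "m > 0" using s by (simp add: m_def)
      moreover have "measure_pmf.prob (spiked t a) S > 0"
        using pmf_access(2)[where g = g and D = "spiked t a", OF inj j(2)] pj t by simp
      ultimately show "0 < m / (t * t) * measure_pmf.prob (spiked t a) S" using t by simp
    qed simp
    also have "\<dots> = pmf (access g (spiked t a) S) r"
      using pmf_access(1)[where g = g and D = "spiked t a", OF inj j(2)] pj t r' by simp
    finally show ?thesis .
  qed
qed

text \<open>The at most \<open>t\<close> spikes whose block contains the answer lose 1 each; the
  \<open>s\<close> spikes in \<open>S\<close> lose \<open>t / (s + t)\<close> each, again at most
  \<open>t\<close> together.\<close>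

lemma likelihood_loss:
  assumes inj: "\<And>D. inj (g D)" and r: "r \<in> set_pmf (access g (unif t) S)"
  shows "(\<Sum>a\<in>{1..t * t}. 1 - likelihood_bound g a S r) \<le> 2 * t"
proof -
  define B where "B = {a \<in> {1..t * t}. \<exists>j\<in>block t a. r = Some (g (unif t) j)}"
  define s where "s = card ({1..t * t} \<inter> S)"
  have "card B \<le> t"
  proof (cases "\<exists>j\<in>{1..t * t} \<inter> S. r = Some (g (unif t) j)")
    case True
    then obtain j where j: "j \<in> {1..t * t}" "r = Some (g (unif t) j)" by auto
    then have "B = {a \<in> {1..t * t}. j \<in> block t a}"
      using inj[of "unif t"] by (auto simp: B_def inj_def)
    then show ?thesis using blocks_containing[OF t j(1)] card_block by simp
  next
    case False
    then have "B = {}" using set_pmf_access_unif[OF r] by (auto simp: B_def)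
    then show ?thesis by simp
  qed
  have "(\<Sum>a\<in>{1..t * t}. 1 - likelihood_bound g a S r)
      \<le> (\<Sum>a\<in>{1..t * t}. (if a \<in> B then 1 else 0) + (if a \<in> S then real t / (s + t) else 0))"
  proof (intro sum_mono)
    fix a assume "a \<in> {1..t * t}"
    moreover have "1 - real s / (s + t) = t / (s + t)" using t by (simp add: diff_divide_eq_iff)
    ultimately show "1 - likelihood_bound g a S r
        \<le> (if a \<in> B then 1 else 0) + (if a \<in> S then real t / (s + t) else 0)"
      unfolding likelihood_bound_def B_def s_def[symmetric] by auto
  qed
  also have "\<dots> = card B + s * (t / (s + t))"
  proof -
    have "{1..t * t} \<inter> B = B" by (auto simp: B_def)
    then show ?thesis
      by (simp add: sum.distrib s_def flip: sum.inter_restrict)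
  qed
  also have "\<dots> \<le> real t + real t"
    using \<open>card B \<le> t\<close> t by (intro add_mono) (auto simp: field_simps)
  finally show ?thesis by simp
qed

section \<open>From indistinguishability to the query bound\<close>

lemma estimator_queries_ge:
  assumes inj: "\<And>D. inj (g D)" and cong: "\<And>D D' j. pmf D j = pmf D' j \<Longrightarrow> g D j = g D' j"
    and t3: "t \<ge> 3" and n: "t * t \<le> n"
    and est: "l2_sq_estimator (access g) n A q"
  shows "real q \<ge> t / 4"
proof -
  define E where "E D = {Some v' | v'. estimate_5_4 v' (l2_sq n D)}" for D
  define N where "N = real t * t"
  have N: "N > 0" using t by (simp add: N_def)
  have good: "measure_pmf.prob (run (access g D) A q []) (E D) \<ge> 2/3" if "D \<in> distributions n" for D
    using est that unfolding l2_sq_estimator_def E_def by blast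
  have far: "measure_pmf.prob (run (access g (spiked t a)) A q []) (E (unif t)) \<le> 1/3"
    if a: "a \<in> {1..t * t}" for a
  proof -
    let ?M = "run (access g (spiked t a)) A q []"
    have "1 / real t \<le> 1 / 3" using t3 by (simp add: field_simps)
    \<comment> \<open>With \<open>t \<ge> 3\<close> the right side is at least
      \<open>4/3 * (1 / N)\<close>, so no output is a valid estimate for both distributions.\<close>
    then have "5/4 * (1 / N) < 4/5 * ((2 - 1 / t) / N)"
      using N by (simp add: field_simps)
    then have "E (unif t) \<inter> E (spiked t a) = {}"
      by (auto simp: E_def estimate_5_4_def l2_sq_unif[OF n] l2_sq_spiked[OF a n] N_def)
    then have "measure_pmf.prob ?M (E (unif t)) + measure_pmf.prob ?M (E (spiked t a))
        = measure_pmf.prob ?M (E (unif t) \<union> E (spiked t a))"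
      by (subst measure_pmf.finite_measure_Union) auto
    also have "\<dots> \<le> 1" by simp
    finally show ?thesis using good[OF spiked_in_distributions[OF a n]] by simp
  qed
  have "(N - q * (2 * t)) * measure_pmf.prob (run (access g (unif t)) A q []) (E (unif t))
      \<le> (\<Sum>a\<in>{1..t * t}. 1 * measure_pmf.prob (run (access g (spiked t a)) A q []) (E (unif t)))"
    using run_prob_sum_ge[where I = "{1..t * t}" and \<delta> = "2 * real t" and W = "likelihood_bound g"
        and Ref = "access g (unif t)" and Orc = "\<lambda>a. access g (spiked t a)" and w = "\<lambda>_. 1"
        and q = q and A = A and h = "[]" and E = "E (unif t)"]
      likelihood_bound_nonneg[of g] likelihood_bound_le_1[of g]
      access_dominated[of g, OF inj cong] likelihood_loss[of g, OF inj]
    by (simp add: N_def)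
  also have "\<dots> \<le> (\<Sum>a\<in>{1..t * t}. 1/3)"
    using far by (intro sum_mono) simp
  finally have *: "(N - q * (2 * t)) * measure_pmf.prob (run (access g (unif t)) A q []) (E (unif t)) \<le> N / 3"
    by (simp add: N_def)
  have "N \<le> 4 * t * q"
  \<comment> \<open>The bound \<open>2/3\<close> can be inserted only for a nonnegative factor; if
    the factor is negative, the claim is immediate.\<close>
  proof (cases "N \<ge> q * (2 * t)")
    case True
    then have "(N - q * (2 * t)) * (2/3)
        \<le> (N - q * (2 * t)) * measure_pmf.prob (run (access g (unif t)) A q []) (E (unif t))"
      using good[OF unif_in_distributions[OF n]] by (intro mult_left_mono) auto
    with * have "(N - q * (2 * t)) * (2/3) \<le> N / 3" by linarith
    then show ?thesis by (simp add: field_simps)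
  next
    case False
    then have "N \<le> 2 * (real q * t)" by simp
    also have "\<dots> \<le> 4 * (real q * t)" by (intro mult_right_mono) auto
    finally show ?thesis by (simp add: mult_ac)
  qed
  then have "real t * t \<le> t * (4 * q)" by (simp add: N_def mult_ac)
  then show ?thesis using t by simp
qed

end

lemma estimator_lower_bound:
  fixes g :: "nat pmf \<Rightarrow> nat \<Rightarrow> 'r"
  assumes inj: "\<And>D. inj (g D)" and cong: "\<And>D D' j. pmf D j = pmf D' j \<Longrightarrow> g D j = g D' j"
  shows "\<exists>c>0. \<exists>k::nat. \<forall>\<^sub>F n in sequentially. \<forall>(A :: 'r option algorithm) q.
    l2_sq_estimator (access g) n A q \<longrightarrow> real q \<ge> c * sqrt (real n) / ln (real n) ^ k"
\<comment> \<open>No logarithmic loss occurs, hence exponent 0. From \<open>n \<ge> 9\<close>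
  follows \<open>t \<ge> 3\<close>, and \<open>sqrt n < t + 1 \<le> 2 * t\<close> turns
  \<open>t / 4\<close> into \<open>sqrt n / 8\<close>.\<close>
proof (rule exI[of _ "1/8"], rule conjI, simp, rule exI[of _ 0], rule eventually_sequentiallyI[of 9],
    intro allI impI)
  fix n :: nat and A :: "'r option algorithm" and q
  assume n: "9 \<le> n" and est: "l2_sq_estimator (access g) n A q"
  define t where "t = nat \<lfloor>sqrt (real n)\<rfloor>"
  have s3: "sqrt (real n) \<ge> 3" using n by (simp add: real_le_rsqrt)
  then have t3: "t \<ge> 3" unfolding t_def by (intro le_nat_floor) simp
  have t: "real t \<le> sqrt n" "sqrt n < real t + 1"
    using s3 by (simp_all add: t_def)
  have "real t * real t \<le> sqrt n * sqrt n" using t by (intro mult_mono) auto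
  then have "t * t \<le> n" by (simp flip: of_nat_mult)
  then have "real q \<ge> t / 4"
    using t3 estimator_queries_ge[where t = t and g = g and A = A, OF _ inj cong t3 _ est] by simp
  then show "1/8 * sqrt (real n) / ln (real n) ^ 0 \<le> real q" using t t3 by simp
qed

theorem theorem4p5:
  "(\<exists>c>0. \<exists>k::nat. \<forall>\<^sub>F n in sequentially.
      \<forall>(A :: (nat \<times> real) option algorithm) q.
        l2_sq_estimator COND_PR n A q \<longrightarrow> real q \<ge> c * sqrt (real n) / ln (real n) ^ k)
   \<and>
   (\<exists>c>0. \<exists>k::nat. \<forall>\<^sub>F n in sequentially.
      \<forall>(A :: nat option algorithm) q.
        l2_sq_estimator COND n A q \<longrightarrow> real q \<ge> c * sqrt (real n) / ln (real n) ^ k)"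
  unfolding COND_eq_access COND_PR_eq_access
  by (intro conjI estimator_lower_bound) (auto simp: inj_def)

end
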